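(* Let $\mathbf{H}$ and $\mathbf{W}$ be square symmetric centrosymmetric matrices of the same size $(2N+1)\times(2N+1)$, such that $$\mathbf{H}=\begin{bmatrix}\mathbf{S}&\mathbf{x}&\mathbf{C}^{T}\\ \mathbf{x}^{T}&h&\mathbf{x}^{T}\mathbf{J}\\ \mathbf{C}&\mathbf{J}\mathbf{x}&\mathbf{J}\mathbf{S}\mathbf{J}\end{bmatrix}\qquad\text{and}\qquad \mathbf{W}=\begin{bmatrix}\mathrm{diag}(\mathbf{w})&\mathbf{0}&\mathbf{0}\\ \mathbf{0}&w&\mathbf{0}\\ \mathbf{0}&\mathbf{0}&\mathbf{J}\,\mathrm{diag}(\mathbf{w})\,\mathbf{J}\end{bmatrix}.$$ Then solving the generalized eigenvalue problem $\det(\mathbf{H}-\lambda\mathbf{W})=0$ is equivalent to solving the two smaller generalized eigenvalue problems $$\det\left(\mathbf{S}-\mathbf{J}\mathbf{C}-\lambda\,\mathrm{diag}(\mathbf{w})\right)=0\quad\text{and}\quad \det\left(\begin{bmatrix}h&\sqrt{2}\,\mathbf{x}^{T}\\ \sqrt{2}\,\mathbf{x}&\mathbf{S}+\mathbf{J}\mathbf{C}\end{bmatrix}-\lambda\begin{bmatrix}w&\mathbf{0}\\ \mathbf{0}&\mathrm{diag}(\mathbf{w})\end{bmatrix}\right)=0;$$ that is, $\lambda$ is a solution of $\det(\mathbf{H}-\lambda\mathbf{W})=0$ if and only if $\lambda$ is a solution of at least one of these two equations.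
   Context: Here $N$ is a positive integer and matrices are real. $\mathbf{S}$ and $\mathbf{C}$ are $N\times N$ matrices with $\mathbf{S}^{T}=\mathbf{S}$ and $\mathbf{C}^{T}=\mathbf{J}\mathbf{C}\mathbf{J}$; $\mathbf{J}$ is the $N\times N$ exchange matrix (ones on the anti-diagonal, zeros elsewhere); $\mathbf{x}$ and $\mathbf{w}$ are column vectors of length $N$; $h$ and $w$ are scalars; $\mathrm{diag}(\mathbf{w})$ is the $N\times N$ diagonal matrix with the entries of $\mathbf{w}$ on its diagonal. A square matrix is centrosymmetric if it commutes with the exchange matrix of its own size. Every symmetric centrosymmetric matrix of size $(2N+1)\times(2N+1)$ has the block form displayed for $\mathbf{H}$. *)

theory Defs
  imports Complex_Main "Jordan_Normal_Form.Determinant"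
begin

definition exchange_mat :: "nat \<Rightarrow> 'a :: {zero, one} mat" where
  "exchange_mat n = mat n n (\<lambda>(i, j). if i + j + 1 = n then 1 else 0)"

definition symmetric_mat :: "'a mat \<Rightarrow> bool" where
  "symmetric_mat A \<longleftrightarrow> square_mat A \<and> transpose_mat A = A"

definition centrosymmetric_mat :: "'a :: semiring_1 mat \<Rightarrow> bool" where
  "centrosymmetric_mat A \<longleftrightarrow>
     square_mat A \<and> A * exchange_mat (dim_row A) = exchange_mat (dim_row A) * A"

definition col_mat :: "'a vec \<Rightarrow> 'a mat" where
  "col_mat v = mat_of_cols (dim_vec v) [v]"

definition scalar_mat :: "'a \<Rightarrow> 'a mat" where
  "scalar_mat a = mat 1 1 (\<lambda>_. a)"

definition diag_of_vec :: "'a :: zero vec \<Rightarrow> 'a mat" where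
  "diag_of_vec v = mat_diag (dim_vec v) (\<lambda>i. v $ i)"

text \<open>Horizontal concatenation, the counterpart of the library's \<open>@\<^sub>r\<close>:
  the two lower blocks have no rows.\<close>

definition append_cols :: "'a :: zero mat \<Rightarrow> 'a mat \<Rightarrow> 'a mat" (infixr \<open>@\<^sub>c\<close> 66) where
  "A @\<^sub>c B = four_block_mat A B (0\<^sub>m 0 (dim_col A)) (0\<^sub>m 0 (dim_col B))"

definition nine_block_mat ::
  "'a :: zero mat \<Rightarrow> 'a mat \<Rightarrow> 'a mat \<Rightarrow>
   'a mat \<Rightarrow> 'a mat \<Rightarrow> 'a mat \<Rightarrow>
   'a mat \<Rightarrow> 'a mat \<Rightarrow> 'a mat \<Rightarrow> 'a mat" where
  "nine_block_mat A11 A12 A13 A21 A22 A23 A31 A32 A33 =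
     (A11 @\<^sub>c A12 @\<^sub>c A13) @\<^sub>r
     (A21 @\<^sub>c A22 @\<^sub>c A23) @\<^sub>r
     (A31 @\<^sub>c A32 @\<^sub>c A33)"

text \<open>\<open>det (A - l B)\<close> for real matrices \<open>A\<close>, \<open>B\<close>. The argument \<open>l\<close> ranges over an
  arbitrary real field, so that real and complex roots are both covered: the pencil can have
  non-real roots even when both matrices are symmetric.\<close>

definition pencil_det :: "real mat \<Rightarrow> real mat \<Rightarrow> 'a :: real_field \<Rightarrow> 'a" where
  "pencil_det A B l = det (map_mat of_real A - l \<cdot>\<^sub>m map_mat of_real B)"

end

theory Submission
  imports Defs
begin

text \<open>
  For a vector \<open>u\<close> of length \<open>N\<close> and a scalar \<open>t\<close>, a centrosymmetric matrix
  maps the antisymmetric vector \<open>(u, 0, -J u)\<close> to an antisymmetric one and the symmetric vector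
  \<open>(u, t, J u)\<close> to a symmetric one. In a basis of the whole space that consists of antisymmetric
  and symmetric vectors the matrix therefore becomes block diagonal. The pencil
  \<open>H - l W\<close> is centrosymmetric for each fixed \<open>l\<close>, with blocks \<open>A = S - l diag w\<close>, \<open>x\<close>,
  \<open>C\<close> and \<open>h - l w0\<close>. On antisymmetric vectors it acts as \<open>A - J C\<close>, and on
  symmetric ones as the block matrix with entries \<open>h - l w0\<close>, a multiple of \<open>x\<close>, and \<open>A + J C\<close>.
  Taking the middle basis vector of length \<open>s\<close> with \<open>s\<^sup>2 = 2\<close> makes all basis vectors equally
  long, and this is what distributes the factor 2 evenly as \<open>sqrt 2\<close> on both sides of the
  diagonal.

  Let \<open>M\<close> be the pencil, \<open>Q\<close> the matrix whose columns are the basis vectors, and \<open>D\<close> the block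
  diagonal matrix. The change of basis \<open>M Q = Q D\<close> is a computation with three-by-three block
  matrices, and \<open>Q\<close> has a nonzero determinant because \<open>Q\<^sup>T Q\<close> is twice the identity. Hence the
  determinant of the pencil \<^emph>\<open>equals\<close> the product of the two smaller determinants (\<open>det_centrosymmetric_blocks\<close>), and
  the equivalence of the equations is the absence of zero divisors.
\<close>

section \<open>Arithmetic of three-by-three block matrices\<close>

lemma append_cols_carrier [simp, intro]:
  assumes "A \<in> carrier_mat n m1" "B \<in> carrier_mat n m2"
  shows "A @\<^sub>c B \<in> carrier_mat n (m1 + m2)"
  using assms unfolding append_cols_def by auto

lemma append_rows_mult:
  fixes A B X :: "'a :: semiring_0 mat"
  assumes "A \<in> carrier_mat n1 k" "B \<in> carrier_mat n2 k" "X \<in> carrier_mat k m"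
  shows "(A @\<^sub>r B) * X = (A * X) @\<^sub>r (B * X)"
  by (rule eq_matI)
    (use assms in \<open>auto simp: append_rows_def row_four_block_mat scalar_prod_def\<close>)

lemma mult_append_cols:
  fixes A B X :: "'a :: semiring_0 mat"
  assumes "X \<in> carrier_mat n k" "A \<in> carrier_mat k m1" "B \<in> carrier_mat k m2"
  shows "X * (A @\<^sub>c B) = (X * A) @\<^sub>c (X * B)"
  by (rule eq_matI)
    (use assms in \<open>auto simp: append_cols_def scalar_prod_def\<close>)

lemma append_cols_mult_append_rows:
  fixes A B X Y :: "'a :: semiring_0 mat"
  assumes "A \<in> carrier_mat n k1" "B \<in> carrier_mat n k2"
    and "X \<in> carrier_mat k1 m" "Y \<in> carrier_mat k2 m"
  shows "(A @\<^sub>c B) * (X @\<^sub>r Y) = A * X + B * Y"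
proof -
  have "(A @\<^sub>c B) * (X @\<^sub>r Y) =
      four_block_mat (A * X + B * Y) (A * 0\<^sub>m k1 0 + B * 0\<^sub>m k2 0)
        (0\<^sub>m 0 k1 * X + 0\<^sub>m 0 k2 * Y) (0\<^sub>m 0 k1 * 0\<^sub>m k1 0 + 0\<^sub>m 0 k2 * 0\<^sub>m k2 0)"
    using assms unfolding append_cols_def append_rows_def
    by (subst mult_four_block_mat) auto
  also have "\<dots> = A * X + B * Y"
    by (rule eq_matI) (use assms in auto)
  finally show ?thesis .
qed

lemma add_append_cols:
  fixes A B A' B' :: "'a :: monoid_add mat"
  assumes "A \<in> carrier_mat n m1" "B \<in> carrier_mat n m2"
    and "A' \<in> carrier_mat n m1" "B' \<in> carrier_mat n m2"
  shows "(A @\<^sub>c B) + (A' @\<^sub>c B') = (A + A') @\<^sub>c (B + B')"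
  by (rule eq_matI) (use assms in \<open>auto simp: append_cols_def\<close>)

lemma block_row_mult_nine_block_mat:
  fixes A1 :: "'a :: semiring_0 mat"
  assumes "A1 \<in> carrier_mat n k1" "A2 \<in> carrier_mat n k2" "A3 \<in> carrier_mat n k3"
    and "B11 \<in> carrier_mat k1 m1" "B12 \<in> carrier_mat k1 m2" "B13 \<in> carrier_mat k1 m3"
    and "B21 \<in> carrier_mat k2 m1" "B22 \<in> carrier_mat k2 m2" "B23 \<in> carrier_mat k2 m3"
    and "B31 \<in> carrier_mat k3 m1" "B32 \<in> carrier_mat k3 m2" "B33 \<in> carrier_mat k3 m3"
  shows "(A1 @\<^sub>c A2 @\<^sub>c A3) * nine_block_mat B11 B12 B13 B21 B22 B23 B31 B32 B33 =
    (A1 * B11 + (A2 * B21 + A3 * B31)) @\<^sub>c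
    (A1 * B12 + (A2 * B22 + A3 * B32)) @\<^sub>c
    (A1 * B13 + (A2 * B23 + A3 * B33))"
proof -
  note c = assms
  have "(A1 @\<^sub>c A2 @\<^sub>c A3) * nine_block_mat B11 B12 B13 B21 B22 B23 B31 B32 B33 =
      A1 * (B11 @\<^sub>c B12 @\<^sub>c B13) + (A2 * (B21 @\<^sub>c B22 @\<^sub>c B23) + A3 * (B31 @\<^sub>c B32 @\<^sub>c B33))"
    unfolding nine_block_mat_def
    by (subst append_cols_mult_append_rows[of _ n k1 _ "k2 + k3" _ "m1 + (m2 + m3)"],
        (use c in auto)[4],
        subst append_cols_mult_append_rows[of _ n k2 _ k3 _ "m1 + (m2 + m3)"])
      (use c in auto)
  also have "A1 * (B11 @\<^sub>c B12 @\<^sub>c B13) = (A1 * B11) @\<^sub>c (A1 * B12) @\<^sub>c (A1 * B13)"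
    using c by (simp add: mult_append_cols[of _ n k1 _ m1 _ "m2 + m3"]
        mult_append_cols[of _ n k1 _ m2 _ m3])
  also have "A2 * (B21 @\<^sub>c B22 @\<^sub>c B23) = (A2 * B21) @\<^sub>c (A2 * B22) @\<^sub>c (A2 * B23)"
    using c by (simp add: mult_append_cols[of _ n k2 _ m1 _ "m2 + m3"]
        mult_append_cols[of _ n k2 _ m2 _ m3])
  also have "A3 * (B31 @\<^sub>c B32 @\<^sub>c B33) = (A3 * B31) @\<^sub>c (A3 * B32) @\<^sub>c (A3 * B33)"
    using c by (simp add: mult_append_cols[of _ n k3 _ m1 _ "m2 + m3"]
        mult_append_cols[of _ n k3 _ m2 _ m3])
  finally show ?thesis
    using c by (simp add: add_append_cols[of _ n m1 _ "m2 + m3"] add_append_cols[of _ n m2 _ m3])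
qed

lemma nine_block_mat_carrier [simp, intro]:
  assumes "A11 \<in> carrier_mat n1 k1" "A12 \<in> carrier_mat n1 k2" "A13 \<in> carrier_mat n1 k3"
    and "A21 \<in> carrier_mat n2 k1" "A22 \<in> carrier_mat n2 k2" "A23 \<in> carrier_mat n2 k3"
    and "A31 \<in> carrier_mat n3 k1" "A32 \<in> carrier_mat n3 k2" "A33 \<in> carrier_mat n3 k3"
  shows "nine_block_mat A11 A12 A13 A21 A22 A23 A31 A32 A33
    \<in> carrier_mat (n1 + (n2 + n3)) (k1 + (k2 + k3))"
  using assms unfolding nine_block_mat_def by blast

lemma nine_block_mat_mult:
  fixes A11 :: "'a :: semiring_0 mat"
  assumes "A11 \<in> carrier_mat n1 k1" "A12 \<in> carrier_mat n1 k2" "A13 \<in> carrier_mat n1 k3"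
    and "A21 \<in> carrier_mat n2 k1" "A22 \<in> carrier_mat n2 k2" "A23 \<in> carrier_mat n2 k3"
    and "A31 \<in> carrier_mat n3 k1" "A32 \<in> carrier_mat n3 k2" "A33 \<in> carrier_mat n3 k3"
    and "B11 \<in> carrier_mat k1 m1" "B12 \<in> carrier_mat k1 m2" "B13 \<in> carrier_mat k1 m3"
    and "B21 \<in> carrier_mat k2 m1" "B22 \<in> carrier_mat k2 m2" "B23 \<in> carrier_mat k2 m3"
    and "B31 \<in> carrier_mat k3 m1" "B32 \<in> carrier_mat k3 m2" "B33 \<in> carrier_mat k3 m3"
  shows "nine_block_mat A11 A12 A13 A21 A22 A23 A31 A32 A33 *
      nine_block_mat B11 B12 B13 B21 B22 B23 B31 B32 B33 =
    nine_block_mat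
      (A11 * B11 + (A12 * B21 + A13 * B31))
      (A11 * B12 + (A12 * B22 + A13 * B32))
      (A11 * B13 + (A12 * B23 + A13 * B33))
      (A21 * B11 + (A22 * B21 + A23 * B31))
      (A21 * B12 + (A22 * B22 + A23 * B32))
      (A21 * B13 + (A22 * B23 + A23 * B33))
      (A31 * B11 + (A32 * B21 + A33 * B31))
      (A31 * B12 + (A32 * B22 + A33 * B32))
      (A31 * B13 + (A32 * B23 + A33 * B33))"
proof -
  let ?B = "nine_block_mat B11 B12 B13 B21 B22 B23 B31 B32 B33"
  have B: "?B \<in> carrier_mat (k1 + (k2 + k3)) (m1 + (m2 + m3))"
    by (rule nine_block_mat_carrier) (fact assms)+
  have rows: "A11 @\<^sub>c A12 @\<^sub>c A13 \<in> carrier_mat n1 (k1 + (k2 + k3))"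
    "A21 @\<^sub>c A22 @\<^sub>c A23 \<in> carrier_mat n2 (k1 + (k2 + k3))"
    "A31 @\<^sub>c A32 @\<^sub>c A33 \<in> carrier_mat n3 (k1 + (k2 + k3))"
    using assms by blast+
  have "nine_block_mat A11 A12 A13 A21 A22 A23 A31 A32 A33 * ?B =
      ((A11 @\<^sub>c A12 @\<^sub>c A13) * ?B) @\<^sub>r ((A21 @\<^sub>c A22 @\<^sub>c A23) * ?B) @\<^sub>r
      ((A31 @\<^sub>c A32 @\<^sub>c A33) * ?B)"
    unfolding nine_block_mat_def[of A11]
    by (simp only: append_rows_mult[OF rows(1) carrier_append_rows[OF rows(2,3)] B]
        append_rows_mult[OF rows(2,3) B])
  also have "(A11 @\<^sub>c A12 @\<^sub>c A13) * ?B =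
    (A11 * B11 + (A12 * B21 + A13 * B31)) @\<^sub>c
    (A11 * B12 + (A12 * B22 + A13 * B32)) @\<^sub>c
    (A11 * B13 + (A12 * B23 + A13 * B33))"
    by (rule block_row_mult_nine_block_mat) (fact assms)+
  also have "(A21 @\<^sub>c A22 @\<^sub>c A23) * ?B =
    (A21 * B11 + (A22 * B21 + A23 * B31)) @\<^sub>c
    (A21 * B12 + (A22 * B22 + A23 * B32)) @\<^sub>c
    (A21 * B13 + (A22 * B23 + A23 * B33))"
    by (rule block_row_mult_nine_block_mat) (fact assms)+
  also have "(A31 @\<^sub>c A32 @\<^sub>c A33) * ?B =
    (A31 * B11 + (A32 * B21 + A33 * B31)) @\<^sub>c
    (A31 * B12 + (A32 * B22 + A33 * B32)) @\<^sub>c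
    (A31 * B13 + (A32 * B23 + A33 * B33))"
    by (rule block_row_mult_nine_block_mat) (fact assms)+
  finally show ?thesis
    unfolding nine_block_mat_def[of "A11 * B11 + _"] .
qed

lemma det_nine_block_mat_decoupled:
  fixes P :: "'a :: idom mat"
  assumes "P \<in> carrier_mat n n"
    and "X \<in> carrier_mat k k" "Y \<in> carrier_mat k m" "Z \<in> carrier_mat m k" "V \<in> carrier_mat m m"
  shows "det (nine_block_mat P (0\<^sub>m n k) (0\<^sub>m n m) (0\<^sub>m k n) X Y (0\<^sub>m m n) Z V) =
    det P * det (four_block_mat X Y Z V)"
proof -
  have "nine_block_mat P (0\<^sub>m n k) (0\<^sub>m n m) (0\<^sub>m k n) X Y (0\<^sub>m m n) Z V =
      four_block_mat P (0\<^sub>m n (k + m)) (0\<^sub>m (k + m) n) (four_block_mat X Y Z V)"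
    by (rule eq_matI)
      (use assms in \<open>auto simp: nine_block_mat_def append_rows_def append_cols_def\<close>)
  then show ?thesis
    using assms by (simp add: det_four_block_mat_lower_left_zero[of _ n _ "k + m"])
qed

section \<open>Splitting into antisymmetric and symmetric vectors\<close>

text \<open>The three block columns of the matrix below are a basis of antisymmetric vectors, the middle
  unit vector stretched by \<open>s\<close>, and a basis of symmetric vectors.\<close>

definition symmetry_basis :: "'a :: ring_1 \<Rightarrow> 'a mat \<Rightarrow> 'a mat" where
  "symmetry_basis s J = (let n = dim_row J in
     nine_block_mat (1\<^sub>m n) (0\<^sub>m n 1) (1\<^sub>m n) (0\<^sub>m 1 n) (s \<cdot>\<^sub>m 1\<^sub>m 1) (0\<^sub>m 1 n) (- J) (0\<^sub>m n 1) J)"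

text \<open>Multiplication by the matrix \<open>R\<close> of the proof gives twice the identity. If \<open>J\<close> is symmetric,
  as the exchange matrix is, then \<open>R\<close> is the transpose of the basis matrix, whose columns are then
  orthogonal; having \<open>J\<close> in \<open>R\<close> in place of its transpose makes the argument work for all
  involutions.\<close>

lemma det_symmetry_basis_nonzero:
  fixes s :: "'a :: idom"
  assumes J: "J \<in> carrier_mat n n" and JJ: "J * J = 1\<^sub>m n"
    and s: "s * s = 2" and two: "(2 :: 'a) \<noteq> 0"
  shows "det (symmetry_basis s J) \<noteq> 0"
proof -
  define R where
    "R = nine_block_mat (1\<^sub>m n) (0\<^sub>m n 1) (- J) (0\<^sub>m 1 n) (s \<cdot>\<^sub>m 1\<^sub>m 1) (0\<^sub>m 1 n) (1\<^sub>m n) (0\<^sub>m n 1) J"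
  have two_id: "1\<^sub>m n + 1\<^sub>m n = (2 :: 'a) \<cdot>\<^sub>m 1\<^sub>m n"
    by (rule eq_matI) auto
  have s_id: "s \<cdot>\<^sub>m (s \<cdot>\<^sub>m 1\<^sub>m 1) = 2 \<cdot>\<^sub>m 1\<^sub>m 1"
    by (rule eq_matI) (auto simp: s)
  have cancel: "1\<^sub>m n + - 1\<^sub>m n = (0\<^sub>m n n :: 'a mat)" "- 0\<^sub>m 1 n = (0\<^sub>m 1 n :: 'a mat)"
    by (auto intro: eq_matI)
  have Q: "symmetry_basis s J = nine_block_mat (1\<^sub>m n) (0\<^sub>m n 1) (1\<^sub>m n)
      (0\<^sub>m 1 n) (s \<cdot>\<^sub>m 1\<^sub>m 1) (0\<^sub>m 1 n) (- J) (0\<^sub>m n 1) J"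
    using J by (simp add: symmetry_basis_def)
  have "R * symmetry_basis s J = nine_block_mat (2 \<cdot>\<^sub>m 1\<^sub>m n) (0\<^sub>m n 1) (0\<^sub>m n n)
      (0\<^sub>m 1 n) (2 \<cdot>\<^sub>m 1\<^sub>m 1) (0\<^sub>m 1 n) (0\<^sub>m n n) (0\<^sub>m n 1) (2 \<cdot>\<^sub>m 1\<^sub>m n)"
    unfolding R_def Q
    by (subst nine_block_mat_mult[of _ n n _ 1 _ n _ 1 _ _ _ n _ _ _ n _ 1 _ n])
      (use J in \<open>simp_all add: JJ two_id s_id cancel
         mult_smult_distrib[of _ 1 1 _ 1] mult_smult_assoc_mat[of _ 1 1 _ 1]
         uminus_l_inv_mat[of _ n n] del: One_nat_def\<close>)
  then have "det (R * symmetry_basis s J) = 2 ^ n * (2 * 2 ^ n)"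
    by (simp add: det_nine_block_mat_decoupled[of _ n _ 1 _ n]
        det_four_block_mat_lower_left_zero[of _ 1 _ n] del: One_nat_def)
  moreover have "det (R * symmetry_basis s J) = det R * det (symmetry_basis s J)"
    unfolding R_def Q
    by (rule det_mult[of _ "n + (1 + n)"]; rule nine_block_mat_carrier; use J in simp)
  ultimately show ?thesis
    using two by auto
qed

text \<open>In the proof \<open>Q\<close> is the basis matrix and \<open>D\<close> the block diagonal matrix with the two
  blocks of the conclusion. Both sides of \<open>M Q = Q D\<close> list the images of the basis vectors.
  The two occurrences of \<open>s\<close> in \<open>D\<close> have different origins: the one next to \<open>b\<close> comes from the length of the middle basis vector,
  the one next to \<open>r\<close> from dividing the middle component \<open>2 r u\<close> of the image of \<open>(u, 0, J u)\<close>
  by that length, as \<open>2 = s * s\<close>.\<close>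

lemma det_centrosymmetric_blocks:
  fixes s :: "'a :: idom"
  assumes A: "A \<in> carrier_mat n n" and C: "C \<in> carrier_mat n n"
    and b: "b \<in> carrier_mat n 1" and r: "r \<in> carrier_mat 1 n" and m: "m \<in> carrier_mat 1 1"
    and J: "J \<in> carrier_mat n n" and JJ: "J * J = 1\<^sub>m n"
    and s: "s * s = 2" and two: "(2 :: 'a) \<noteq> 0"
  shows "det (nine_block_mat A b (J * C * J) r m (r * J) C (J * b) (J * A * J)) =
    det (A - J * C) * det (four_block_mat m (s \<cdot>\<^sub>m r) (s \<cdot>\<^sub>m b) (A + J * C))"
    (is "det ?M = _")
proof -
  let ?Q = "symmetry_basis s J"
  define D where "D = nine_block_mat (A - J * C) (0\<^sub>m n 1) (0\<^sub>m n n)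
    (0\<^sub>m 1 n) m (s \<cdot>\<^sub>m r) (0\<^sub>m n n) (s \<cdot>\<^sub>m b) (A + J * C)"
  have Q: "?Q = nine_block_mat (1\<^sub>m n) (0\<^sub>m n 1) (1\<^sub>m n)
      (0\<^sub>m 1 n) (s \<cdot>\<^sub>m 1\<^sub>m 1) (0\<^sub>m 1 n) (- J) (0\<^sub>m n 1) J"
    using J by (simp add: symmetry_basis_def)
  have cancel_right: "X * J * J = X" if "X \<in> carrier_mat k n" for X k
    using that J JJ by (simp add: assoc_mult_mat[of _ k n _ n _ n])
  have cancel_left: "J * (J * X) = X" if "X \<in> carrier_mat n k" for X k
    using that J JJ by (simp flip: assoc_mult_mat[of _ n n _ n _ k])
  note JA = mult_carrier_mat[OF J A] and JC = mult_carrier_mat[OF J C]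
  have doubling: "r + r = 2 \<cdot>\<^sub>m r" "s \<cdot>\<^sub>m (s \<cdot>\<^sub>m r) = 2 \<cdot>\<^sub>m r"
    by (rule eq_matI; simp add: s flip: mult.assoc)+
  have swap: "- X - - C = C - X" and comm: "X + C = C + X" if "X \<in> carrier_mat n n" for X
    by (rule eq_matI; use that C in simp)+
  have minus: "X + (0\<^sub>m k n - Y) = X - Y" if "X \<in> carrier_mat k n" "Y \<in> carrier_mat k n"
    for X Y :: "'a mat" and k
    by (rule eq_matI; use that in simp)
  note block_simps = minus[OF A JC] minus[OF r r] minus[OF C JA] doubling swap[OF JA] comm[OF JA]
    cancel_right[OF JA] cancel_right[OF JC] cancel_right[OF r] cancel_left[OF C]
    add_uminus_minus_mat[of _ n n] add_uminus_minus_mat[of _ 1 n]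
    mult_smult_distrib[of _ n 1 _ 1] mult_smult_distrib[of _ 1 1 _ 1]
    mult_smult_distrib[of _ n n _ 1]
    mult_smult_assoc_mat[of _ 1 1 _ 1] mult_smult_assoc_mat[of _ 1 1 _ n]
    mult_add_distrib_mat[of _ n n _ n] mult_minus_distrib_mat[of _ n n _ n]
  have MQ: "?M * ?Q = nine_block_mat (A - J * C) (s \<cdot>\<^sub>m b) (A + J * C)
      (0\<^sub>m 1 n) (s \<cdot>\<^sub>m m) (2 \<cdot>\<^sub>m r) (C - J * A) (s \<cdot>\<^sub>m (J * b)) (C + J * A)"
    unfolding Q
    by (subst nine_block_mat_mult[of _ n n _ 1 _ n _ 1 _ _ _ n _ _ _ n _ 1 _ n])
      (use A C b r m J JA JC mult_carrier_mat[OF JA J] mult_carrier_mat[OF JC J] in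
        \<open>simp_all add: block_simps minus_carrier_mat del: One_nat_def assoc_mult_mat\<close>)
  have QD: "?Q * D = nine_block_mat (A - J * C) (s \<cdot>\<^sub>m b) (A + J * C)
      (0\<^sub>m 1 n) (s \<cdot>\<^sub>m m) (2 \<cdot>\<^sub>m r) (C - J * A) (s \<cdot>\<^sub>m (J * b)) (C + J * A)"
    unfolding Q D_def
    by (subst nine_block_mat_mult[of _ n n _ 1 _ n _ 1 _ _ _ n _ _ _ n _ 1 _ n])
      (use A C b r m J JA JC mult_carrier_mat[OF JA J] mult_carrier_mat[OF JC J] in
        \<open>simp_all add: block_simps minus_carrier_mat del: One_nat_def assoc_mult_mat\<close>)
  have carriers: "?M \<in> carrier_mat (n + (1 + n)) (n + (1 + n))"
    "?Q \<in> carrier_mat (n + (1 + n)) (n + (1 + n))" "D \<in> carrier_mat (n + (1 + n)) (n + (1 + n))"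
    unfolding Q D_def
    by (rule nine_block_mat_carrier; use A C b r m J in \<open>simp add: minus_carrier_mat\<close>)+
  have "det ?M * det ?Q = det ?Q * det D"
    using MQ QD carriers by (metis det_mult)
  then have "det ?M = det D"
    using det_symmetry_basis_nonzero[OF J JJ s two] by simp
  also have "\<dots> = det (A - J * C) * det (four_block_mat m (s \<cdot>\<^sub>m r) (s \<cdot>\<^sub>m b) (A + J * C))"
    unfolding D_def by (rule det_nine_block_mat_decoupled) (use A C b r m J in auto)
  finally show ?thesis .
qed

section \<open>Pencils of block matrices\<close>

lemma exchange_mat_carrier [simp]: "exchange_mat n \<in> carrier_mat n n"
  by (simp add: exchange_mat_def)

lemma exchange_mat_involution:
  "exchange_mat n * exchange_mat n = (1\<^sub>m n :: 'a :: semiring_1 mat)"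
proof (rule eq_matI)
  fix i j
  assume "i < dim_row (1\<^sub>m n :: 'a mat)" and "j < dim_col (1\<^sub>m n :: 'a mat)"
  then have i: "i < n" and j: "j < n" by simp_all
  have "(exchange_mat n * exchange_mat n :: 'a mat) $$ (i, j) =
      (\<Sum>k = 0..<n. (if i + k + 1 = n then 1 else 0) * (if k + j + 1 = n then 1 else 0))"
    using i j by (simp add: exchange_mat_def scalar_prod_def)
  \<comment> \<open>Row \<open>i\<close> has its only nonzero entry in column \<open>n - 1 - i\<close>.\<close>
  also have "\<dots> = (\<Sum>k = 0..<n. if k = n - 1 - i then if i = j then 1 else 0 else 0)"
    using i j by (intro sum.cong) auto
  also have "\<dots> = (if i = j then 1 else 0)"
    using i by simp
  finally show "(exchange_mat n * exchange_mat n :: 'a mat) $$ (i, j) = 1\<^sub>m n $$ (i, j)"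
    using i j by simp
qed (simp_all add: exchange_mat_def)

lemma map_of_real_exchange_mat:
  "map_mat of_real (exchange_mat n) = (exchange_mat n :: 'a :: real_algebra_1 mat)"
  by (rule eq_matI) (auto simp: exchange_mat_def)

abbreviation pencil :: "real mat \<Rightarrow> real mat \<Rightarrow> 'a :: real_field \<Rightarrow> 'a mat" where
  "pencil A B l \<equiv> map_mat of_real A - l \<cdot>\<^sub>m map_mat of_real B"

lemma pencil_nine_block_mat:
  fixes l :: "'a :: real_field"
  assumes "A11 \<in> carrier_mat n1 k1" "A12 \<in> carrier_mat n1 k2" "A13 \<in> carrier_mat n1 k3"
    and "A21 \<in> carrier_mat n2 k1" "A22 \<in> carrier_mat n2 k2" "A23 \<in> carrier_mat n2 k3"
    and "A31 \<in> carrier_mat n3 k1" "A32 \<in> carrier_mat n3 k2" "A33 \<in> carrier_mat n3 k3"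
    and "B11 \<in> carrier_mat n1 k1" "B12 \<in> carrier_mat n1 k2" "B13 \<in> carrier_mat n1 k3"
    and "B21 \<in> carrier_mat n2 k1" "B22 \<in> carrier_mat n2 k2" "B23 \<in> carrier_mat n2 k3"
    and "B31 \<in> carrier_mat n3 k1" "B32 \<in> carrier_mat n3 k2" "B33 \<in> carrier_mat n3 k3"
  shows "pencil (nine_block_mat A11 A12 A13 A21 A22 A23 A31 A32 A33)
      (nine_block_mat B11 B12 B13 B21 B22 B23 B31 B32 B33) l =
    nine_block_mat (pencil A11 B11 l) (pencil A12 B12 l) (pencil A13 B13 l)
      (pencil A21 B21 l) (pencil A22 B22 l) (pencil A23 B23 l)
      (pencil A31 B31 l) (pencil A32 B32 l) (pencil A33 B33 l)"
  by (rule eq_matI)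
    (use assms in \<open>auto simp: nine_block_mat_def append_rows_def append_cols_def\<close>)

lemma pencil_four_block_mat:
  fixes l :: "'a :: real_field"
  assumes "A11 \<in> carrier_mat n1 k1" "A12 \<in> carrier_mat n1 k2"
    and "A21 \<in> carrier_mat n2 k1" "A22 \<in> carrier_mat n2 k2"
    and "B11 \<in> carrier_mat n1 k1" "B12 \<in> carrier_mat n1 k2"
    and "B21 \<in> carrier_mat n2 k1" "B22 \<in> carrier_mat n2 k2"
  shows "pencil (four_block_mat A11 A12 A21 A22) (four_block_mat B11 B12 B21 B22) l =
    four_block_mat (pencil A11 B11 l) (pencil A12 B12 l) (pencil A21 B21 l) (pencil A22 B22 l)"
  by (rule eq_matI) (use assms in auto)

lemma pencil_zero:
  fixes l :: "'a :: real_field"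
  assumes "A \<in> carrier_mat n k"
  shows "pencil A (0\<^sub>m n k) l = map_mat of_real A"
  by (rule eq_matI) (use assms in auto)

lemma pencil_conjugate:
  fixes l :: "'a :: real_field"
  assumes "A \<in> carrier_mat n n" "B \<in> carrier_mat n n" "P \<in> carrier_mat n n"
  shows "pencil (P * A * P) (P * B * P) l = map_mat of_real P * pencil A B l * map_mat of_real P"
  using assms
  by (simp add: of_real_hom.mat_hom_mult[of _ n n _ n] minus_mult_distrib_mat[of _ n n _ _ n]
      mult_minus_distrib_mat[of _ n n _ n] mult_smult_distrib[of _ n n _ n]
      mult_smult_assoc_mat[of _ n n _ n])

lemma col_mat_carrier [simp]: "v \<in> carrier_vec n \<Longrightarrow> col_mat v \<in> carrier_mat n 1"
  by (simp add: col_mat_def carrier_matI)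

lemma scalar_mat_carrier [simp]: "scalar_mat a \<in> carrier_mat 1 1"
  by (simp add: scalar_mat_def)

lemma diag_of_vec_carrier [simp]: "v \<in> carrier_vec n \<Longrightarrow> diag_of_vec v \<in> carrier_mat n n"
  by (simp add: diag_of_vec_def)

theorem theorem3p9:
  fixes N :: nat
    and S C J H W :: "real mat"
    and x w :: "real vec"
    and h w0 :: real
    and l :: "'a :: real_field"
  assumes "N > 0"
    and "J = exchange_mat N"
    and "S \<in> carrier_mat N N" and "transpose_mat S = S"
    and "C \<in> carrier_mat N N" and "transpose_mat C = J * C * J"
    and "x \<in> carrier_vec N" and "w \<in> carrier_vec N"
    and "H \<in> carrier_mat (2 * N + 1) (2 * N + 1)"
    and "W \<in> carrier_mat (2 * N + 1) (2 * N + 1)"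
    and "symmetric_mat H" and "centrosymmetric_mat H"
    and "symmetric_mat W" and "centrosymmetric_mat W"
    and "H = nine_block_mat
               S                           (col_mat x)           (transpose_mat C)
               (transpose_mat (col_mat x)) (scalar_mat h)        (transpose_mat (col_mat x) * J)
               C                           (J * col_mat x)       (J * S * J)"
    and "W = nine_block_mat
               (diag_of_vec w)             (0\<^sub>m N 1)             (0\<^sub>m N N)
               (0\<^sub>m 1 N)                   (scalar_mat w0)       (0\<^sub>m 1 N)
               (0\<^sub>m N N)                   (0\<^sub>m N 1)             (J * diag_of_vec w * J)"
  shows "pencil_det H W l = 0 \<longleftrightarrow>
           pencil_det (S - J * C) (diag_of_vec w) l = 0 \<or>
           pencil_det
             (four_block_mat
                (scalar_mat h)             (sqrt 2 \<cdot>\<^sub>m transpose_mat (col_mat x))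
                (sqrt 2 \<cdot>\<^sub>m col_mat x)     (S + J * C))
             (four_block_mat
                (scalar_mat w0)            (0\<^sub>m 1 N)
                (0\<^sub>m N 1)                  (diag_of_vec w))
             l = 0"
proof -
  let ?R = "map_mat (of_real :: real \<Rightarrow> 'a)"
  let ?E = "exchange_mat N :: 'a mat"
  let ?A = "pencil S (diag_of_vec w) l"
  let ?b = "?R (col_mat x)" and ?r = "?R (transpose_mat (col_mat x))"
  let ?m = "pencil (scalar_mat h) (scalar_mat w0) l"
  define s :: 'a where "s = of_real (sqrt 2)"
  have s: "s * s = 2"
    unfolding s_def by (simp flip: of_real_mult)
  note J = \<open>J = exchange_mat N\<close>
  note S = \<open>S \<in> carrier_mat N N\<close> and C = \<open>C \<in> carrier_mat N N\<close>
  note x = col_mat_carrier[OF \<open>x \<in> carrier_vec N\<close>]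
    and w = diag_of_vec_carrier[OF \<open>w \<in> carrier_vec N\<close>]
  have J_carrier: "J \<in> carrier_mat N N"
    by (simp add: J)
  have RJ: "?R J = ?E"
    by (simp add: J map_of_real_exchange_mat)
  note carriers = S C x w J_carrier
  have RJC: "?E * ?R C = ?R (J * C)"
    using carriers by (simp add: RJ of_real_hom.mat_hom_mult[of _ N N _ N])
  have "pencil H W l = nine_block_mat ?A ?b (?E * ?R C * ?E) ?r ?m (?r * ?E)
      (?R C) (?E * ?b) (?E * ?A * ?E)"
  proof -
    have "pencil H W l = nine_block_mat ?A (pencil (col_mat x) (0\<^sub>m N 1) l)
       (pencil (J * C * J) (0\<^sub>m N N) l) (pencil (transpose_mat (col_mat x)) (0\<^sub>m 1 N) l) ?m
       (pencil (transpose_mat (col_mat x) * J) (0\<^sub>m 1 N) l) (pencil C (0\<^sub>m N N) l)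
       (pencil (J * col_mat x) (0\<^sub>m N 1) l)
       (pencil (J * S * J) (J * diag_of_vec w * J) l)"
      unfolding assms(15,16) \<open>transpose_mat C = J * C * J\<close>
      by (rule pencil_nine_block_mat[of _ N N _ 1 _ N _ 1 _ _ _ N])
        (use carriers in \<open>simp_all del: One_nat_def\<close>)
    also have "pencil (J * S * J) (J * diag_of_vec w * J) l = ?E * ?A * ?E"
      unfolding RJ[symmetric] by (rule pencil_conjugate) (use carriers in auto)
    also have "pencil (J * C * J) (0\<^sub>m N N) l = ?E * ?R C * ?E"
      using carriers mult_carrier_mat[OF J_carrier C]
      by (subst pencil_zero[OF mult_carrier_mat[OF mult_carrier_mat[OF J_carrier C] J_carrier]])
        (simp_all add: of_real_hom.mat_hom_mult[of _ N N _ N] RJ del: assoc_mult_mat)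
    also have "pencil (transpose_mat (col_mat x) * J) (0\<^sub>m 1 N) l = ?r * ?E"
      using carriers
      by (subst pencil_zero)
        (simp_all add: of_real_hom.mat_hom_mult[of _ 1 N _ N] RJ del: One_nat_def)
    also have "pencil (J * col_mat x) (0\<^sub>m N 1) l = ?E * ?b"
      using carriers
      by (subst pencil_zero)
        (simp_all add: of_real_hom.mat_hom_mult[of _ N N _ 1] RJ del: One_nat_def)
    finally show ?thesis
      using carriers
      by (simp add: pencil_zero[of _ N N] pencil_zero[of _ N 1] pencil_zero[of _ 1 N]
          del: One_nat_def assoc_mult_mat)
  qed
  then have "pencil_det H W l = det (?A - ?E * ?R C) *
      det (four_block_mat ?m (s \<cdot>\<^sub>m ?r) (s \<cdot>\<^sub>m ?b) (?A + ?E * ?R C))"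
    unfolding pencil_det_def
    by (simp only:, intro det_centrosymmetric_blocks[of _ N])
      (use carriers s in \<open>auto simp: exchange_mat_involution minus_carrier_mat simp del: One_nat_def\<close>)
  moreover have "pencil (S - J * C) (diag_of_vec w) l = ?A - ?E * ?R C"
    unfolding RJC by (intro eq_matI) (use carriers in auto)
  moreover have "pencil
      (four_block_mat (scalar_mat h) (sqrt 2 \<cdot>\<^sub>m transpose_mat (col_mat x))
        (sqrt 2 \<cdot>\<^sub>m col_mat x) (S + J * C))
      (four_block_mat (scalar_mat w0) (0\<^sub>m 1 N) (0\<^sub>m N 1) (diag_of_vec w)) l =
    four_block_mat ?m (s \<cdot>\<^sub>m ?r) (s \<cdot>\<^sub>m ?b) (?A + ?E * ?R C)"
  proof -
    have "pencil (S + J * C) (diag_of_vec w) l = ?A + ?E * ?R C"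
      unfolding RJC by (intro eq_matI) (use carriers in auto)
    moreover have "pencil (sqrt 2 \<cdot>\<^sub>m transpose_mat (col_mat x)) (0\<^sub>m 1 N) l = s \<cdot>\<^sub>m ?r"
      by (rule eq_matI) (use carriers in \<open>auto simp: s_def\<close>)
    moreover have "pencil (sqrt 2 \<cdot>\<^sub>m col_mat x) (0\<^sub>m N 1) l = s \<cdot>\<^sub>m ?b"
      by (rule eq_matI) (use carriers in \<open>auto simp: s_def\<close>)
    ultimately show ?thesis
      using carriers by (subst pencil_four_block_mat[of _ 1 1 _ N _ N]) (simp_all del: One_nat_def)
  qed
  ultimately show ?thesis
    by (simp add: pencil_det_def)
qed

end
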